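(* Let $\{W(k)\}$ be a random model of $m\times m$ stochastic matrices that belongs to the class $\mathscr{M}_2$ and has weak feedback property. Then the following conditions are equivalent: (a) The model $\{W(k)\}$ is ergodic. (b) The model $\{W(k)\}$ has infinite flow property. (c) The expected model $\{\mathsf{E}[W(k)]\}$ has infinite flow property. (d) The expected model $\{\mathsf{E}[W(k)]\}$ is ergodic.
   Context: $[m]=\{1,\dots,m\}$. A stochastic matrix is a nonnegative matrix whose rows each sum to $1$. A random model $\{W(k)\}_{k\ge0}$ is a sequence of random $m\times m$ stochastic matrices on a probability space; it is independent if the matrices $W(k)$ are independent. A deterministic chain is viewed as a special independent random model. Associated dynamics: $x(k+1)=W(k)x(k)$ for $k\ge t_0$, with initial time $t_0\ge0$ and (deterministic) initial state $x(t_0)\in\mathbb{R}^m$. $W^i$ denotes the $i$th column of $W$. Class $\mathscr{M}_2$: an independent random model $\{W(k)\}$ belongs to $\mathscr{M}_2$ if for every $t_0\ge0$ and every $x(t_0)\in\mathbb{R}^m$ the dynamics satisfies $$\sum_{k=t_0}^\infty\sum_{i<j}H_{ij}(k)\,\mathsf{E}[(x_i(k)-x_j(k))^2]<\infty,\qquad H(k)=\mathsf{E}[W^T(k)W(k)].$$ Weak feedback property: there is $\gamma>0$ with $\mathsf{E}[W^i(k)^TW^j(k)]\ge\gamma(\mathsf{E}[W_{ij}(k)]+\mathsf{E}[W_{ji}(k)])$ for all $k\ge0$ and all $i\ne j$ in $[m]$. A deterministic chain is ergodic if $\lim_{k\to\infty}(x_i(k)-x_j(k))=0$ for all $i,j\in[m]$,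 all $t_0\ge0$ and all $x(t_0)\in\mathbb{R}^m$; a random model is ergodic if this holds almost surely (for almost every realization of the chain). Infinite flow property: for $S\subset[m]$ and $\bar S=[m]\setminus S$, let $W_S(k)=\sum_{i\in S,\,j\in\bar S}(W_{ij}(k)+W_{ji}(k))$. A deterministic chain has infinite flow property if $\sum_{k=0}^\infty W_S(k)=\infty$ for every nonempty proper subset $S$ of $[m]$; a random model has it if this holds almost surely. *)

theory Defs
  imports "HOL-Probability.Probability"
begin

text \<open>
  Matrices are indexed by a finite linearly ordered type \<open>'m\<close> standing for \<open>[m] = {1,...,m}\<close>;
  the order is only needed for the sum over \<open>i < j\<close>.
\<close>

definition stochastic :: "real^'m::finite^'m \<Rightarrow> bool" where
  "stochastic A \<longleftrightarrow> (\<forall>i j. 0 \<le> A $ i $ j) \<and> (\<forall>i. (\<Sum>j\<in>UNIV. A $ i $ j) = 1)"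

definition random_model :: "'w measure \<Rightarrow> (nat \<Rightarrow> 'w \<Rightarrow> real^'m::finite^'m) \<Rightarrow> bool" where
  "random_model M W \<longleftrightarrow> prob_space M \<and>
     (\<forall>k. W k \<in> borel_measurable M) \<and>
     (\<forall>k. \<forall>\<omega>\<in>space M. stochastic (W k \<omega>))"

definition independent_model :: "'w measure \<Rightarrow> (nat \<Rightarrow> 'w \<Rightarrow> real^'m::finite^'m) \<Rightarrow> bool" where
  "independent_model M W \<longleftrightarrow>
     random_model M W \<and> prob_space.indep_vars M (\<lambda>_. borel) W UNIV"

text \<open>
  State at time \<open>k\<close> of the dynamics started from \<open>x0\<close> at time \<open>t0\<close>. Only times \<open>k \<ge> t0\<close> are
  meaningful; for \<open>k < t0\<close> the value is \<open>x0\<close> by convention.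
\<close>

primrec dynamics ::
  "(nat \<Rightarrow> real^'m::finite^'m) \<Rightarrow> nat \<Rightarrow> real^'m \<Rightarrow> nat \<Rightarrow> real^'m" where
  "dynamics A t0 x0 0 = x0"
| "dynamics A t0 x0 (Suc k) = (if t0 \<le> k then A k *v dynamics A t0 x0 k else x0)"

definition expected_model ::
  "'w measure \<Rightarrow> (nat \<Rightarrow> 'w \<Rightarrow> real^'m::finite^'m) \<Rightarrow> nat \<Rightarrow> real^'m^'m" where
  "expected_model M W k = (\<integral>\<omega>. W k \<omega> \<partial>M)"

definition second_moment ::
  "'w measure \<Rightarrow> (nat \<Rightarrow> 'w \<Rightarrow> real^'m::finite^'m) \<Rightarrow> nat \<Rightarrow> real^'m^'m" where
  "second_moment M W k = (\<integral>\<omega>. transpose (W k \<omega>) ** W k \<omega> \<partial>M)"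

text \<open>
  All terms of the series are nonnegative, so finiteness of the sum is summability; the series
  over \<open>k \<ge> t0\<close> is written with \<open>k = t0 + n\<close>.
\<close>

definition class_M2 ::
  "'w measure \<Rightarrow> (nat \<Rightarrow> 'w \<Rightarrow> real^'m::{finite,linorder}^'m::{finite,linorder}) \<Rightarrow> bool" where
  "class_M2 M W \<longleftrightarrow> independent_model M W \<and>
     (\<forall>t0 x0. summable (\<lambda>n. \<Sum>(i, j)\<in>{(i, j). i < j}.
        second_moment M W (t0 + n) $ i $ j *
        (\<integral>\<omega>. (dynamics (\<lambda>k. W k \<omega>) t0 x0 (t0 + n) $ i -
              dynamics (\<lambda>k. W k \<omega>) t0 x0 (t0 + n) $ j)\<^sup>2 \<partial>M)))"

definition weak_feedback :: "'w measure \<Rightarrow> (nat \<Rightarrow> 'w \<Rightarrow> real^'m::finite^'m) \<Rightarrow> bool" where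
  "weak_feedback M W \<longleftrightarrow> (\<exists>\<gamma>>0. \<forall>k i j. i \<noteq> j \<longrightarrow>
     (\<integral>\<omega>. column i (W k \<omega>) \<bullet> column j (W k \<omega>) \<partial>M)
       \<ge> \<gamma> * ((\<integral>\<omega>. W k \<omega> $ i $ j \<partial>M) + (\<integral>\<omega>. W k \<omega> $ j $ i \<partial>M)))"

definition ergodic_chain :: "(nat \<Rightarrow> real^'m::finite^'m) \<Rightarrow> bool" where
  "ergodic_chain A \<longleftrightarrow> (\<forall>t0 x0 i j.
     (\<lambda>k. dynamics A t0 x0 k $ i - dynamics A t0 x0 k $ j) \<longlonglongrightarrow> 0)"

definition ergodic_model :: "'w measure \<Rightarrow> (nat \<Rightarrow> 'w \<Rightarrow> real^'m::finite^'m) \<Rightarrow> bool" where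
  "ergodic_model M W \<longleftrightarrow> (AE \<omega> in M. ergodic_chain (\<lambda>k. W k \<omega>))"

definition flow :: "real^'m::finite^'m \<Rightarrow> 'm set \<Rightarrow> real" where
  "flow A S = (\<Sum>i\<in>S. \<Sum>j\<in>- S. A $ i $ j + A $ j $ i)"

definition infinite_flow_chain :: "(nat \<Rightarrow> real^'m::finite^'m) \<Rightarrow> bool" where
  "infinite_flow_chain A \<longleftrightarrow>
     (\<forall>S. S \<noteq> {} \<and> S \<noteq> UNIV \<longrightarrow> (\<Sum>k. ennreal (flow (A k) S)) = \<infinity>)"

definition infinite_flow_model ::
  "'w measure \<Rightarrow> (nat \<Rightarrow> 'w \<Rightarrow> real^'m::finite^'m) \<Rightarrow> bool" where
  "infinite_flow_model M W \<longleftrightarrow> (AE \<omega> in M. infinite_flow_chain (\<lambda>k. W k \<omega>))"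

end

theory Submission imports Defs begin

text \<open>
  The core is a deterministic criterion: if \<open>\<Sum>\<^sub>k A\<^sub>i\<^sub>j(k) (x\<^sub>i(k) - x\<^sub>j(k))\<^sup>2\<close> converges along a
  trajectory \<open>x\<close> of a chain with infinite flow, then \<open>x\<close> reaches consensus. Otherwise the spread stays
  above some \<open>D > 0\<close>, so at any time \<open>T\<close> the states split at a gap of at least \<open>D / m\<close> into two sets.
  If the tail of the series beyond \<open>T\<close> is small, this gap never closes, and then the flow between the
  two sets is finite. Under weak feedback, membership in the class \<open>M\<^sub>2\<close> makes the series converge almost
  surely, so infinite flow gives ergodicity. Infinite flow of the model and of its expectation agree
  because sums of independent bounded nonnegative variables converge almost surely if and only if the sums of
  expectations do. Ergodicity passes to the expected chain by dominated convergence, and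
  ergodicity implies infinite flow for every deterministic chain.
\<close>

section \<open>Deterministic chains\<close>

lemma flow_nonneg: "stochastic A \<Longrightarrow> 0 \<le> flow A S"
  by (auto simp: flow_def stochastic_def intro!: sum_nonneg add_nonneg_nonneg)

lemma flow_Compl: "flow A (- S) = flow A S"
  unfolding flow_def by (subst sum.swap) (simp add: add.commute)

text \<open>Flows are nonnegative, so an infinite \<open>ennreal\<close> sum is the same as a
  divergent real series. All later arguments use the real form.\<close>

lemma infinite_flow_chain_iff:
  assumes "\<And>k. stochastic (A k)"
  shows "infinite_flow_chain A \<longleftrightarrow>
    (\<forall>S. S \<noteq> {} \<and> S \<noteq> UNIV \<longrightarrow> \<not> summable (\<lambda>k. flow (A k) S))"
proof -
  have "(\<Sum>k. ennreal (flow (A k) S)) = \<infinity> \<longleftrightarrow> \<not> summable (\<lambda>k. flow (A k) S)" for S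
    using flow_nonneg[OF assms] summable_suminf_not_top[of "\<lambda>k. flow (A k) S"]
      ennreal_suminf_neq_top[of "\<lambda>k. flow (A k) S"]
    by (metis infinity_ennreal_def)
  then show ?thesis
    unfolding infinite_flow_chain_def by simp
qed

section \<open>Averaging by a stochastic matrix and the drift of separated states\<close>

lemma stochastic_mult_ge:
  assumes "stochastic A" "\<And>i. c \<le> x $ i"
  shows "c \<le> (A *v x) $ i"
proof -
  have "c = (\<Sum>j\<in>UNIV. A $ i $ j * c)"
    using assms(1) by (simp add: stochastic_def flip: sum_distrib_right)
  also have "\<dots> \<le> (\<Sum>j\<in>UNIV. A $ i $ j * x $ j)"
    using assms by (intro sum_mono mult_left_mono) (auto simp: stochastic_def)
  finally show ?thesis
    by (simp add: matrix_vector_mult_def)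
qed

lemma stochastic_mult_le:
  assumes "stochastic A" "\<And>i. x $ i \<le> c"
  shows "(A *v x) $ i \<le> c"
  using stochastic_mult_ge[of A "- c" "- x" i] assms
  by (simp add: matrix_vector_mult_def sum_negf)

lemma dynamics_abs_le:
  assumes "\<And>k. stochastic (A k)" "\<And>i. \<bar>x0 $ i\<bar> \<le> c"
  shows "\<bar>dynamics A t0 x0 k $ i\<bar> \<le> c"
proof (induction k arbitrary: i)
  case 0
  then show ?case using assms by simp
next
  case (Suc k)
  have "- c \<le> dynamics A t0 x0 k $ i" "dynamics A t0 x0 k $ i \<le> c" for i
    using Suc[of i] by auto
  then show ?case
    using assms stochastic_mult_ge[of "A k" "- c" "dynamics A t0 x0 k" i]
      stochastic_mult_le[of "A k" "dynamics A t0 x0 k" c i] by auto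
qed

text \<open>Row \<open>i\<close> puts a weight \<open>p\<close> on the complement of
  \<open>S\<close>, and \<open>p\<close> is at most the flow. The rest of the row averages values of
  at least \<open>u\<close>, and states outside contribute nonnegatively, so the new value is at
  least \<open>u * (1 - p)\<close>. The bound \<open>u \<le> 1\<close> turns this into
  \<open>u - p\<close>.\<close>

lemma stochastic_mult_separation:
  assumes A: "stochastic A" and x: "\<And>i. 0 \<le> x $ i" "\<And>i. x $ i \<le> 1" and u: "u \<le> 1"
    and S: "\<And>i. i \<in> S \<Longrightarrow> u \<le> x $ i" and i: "i \<in> S"
  shows "u - flow A S \<le> (A *v x) $ i"
proof -
  have nn: "0 \<le> A $ i $ j" for i j
    using A by (simp add: stochastic_def)
  have split: "sum f UNIV = sum f S + sum f (- S)" for f :: "'a \<Rightarrow> real"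
    using sum.union_disjoint[of S "- S" f] by (simp add: Compl_partition)
  define p where "p = (\<Sum>j\<in>- S. A $ i $ j)"
  have p0: "0 \<le> p"
    unfolding p_def by (simp add: nn sum_nonneg)
  have "p \<le> (\<Sum>j\<in>- S. A $ i $ j + A $ j $ i)"
    unfolding p_def by (intro sum_mono) (simp add: nn)
  also have "\<dots> \<le> flow A S"
    unfolding flow_def by (rule member_le_sum) (use i in \<open>auto intro!: sum_nonneg simp: nn\<close>)
  finally have p1: "p \<le> flow A S" .
  have "(\<Sum>j\<in>S. A $ i $ j) = 1 - p"
    using A split[of "\<lambda>j. A $ i $ j"] by (simp add: stochastic_def p_def)
  then have "u * (1 - p) = (\<Sum>j\<in>S. A $ i $ j * u)"
    by (simp flip: sum_distrib_right)
  also have "\<dots> \<le> (\<Sum>j\<in>S. A $ i $ j * x $ j)"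
    by (intro sum_mono mult_left_mono S nn)
  also have "\<dots> \<le> (A *v x) $ i"
    using split[of "\<lambda>j. A $ i $ j * x $ j"]
    by (simp add: matrix_vector_mult_def x nn sum_nonneg)
  finally have "u - u * p \<le> (A *v x) $ i"
    by (simp add: algebra_simps)
  moreover have "u * p \<le> p"
    using mult_right_mono[OF u p0] by simp
  ultimately show ?thesis using p1 by linarith
qed

text \<open>Iterates \<open>stochastic_mult_separation\<close>: the two levels approach each other
  only through the flow across \<open>S\<close>, each by at most the accumulated flow.\<close>

lemma separation_drift:
  assumes A: "\<And>k. stochastic (A k)" and step: "\<And>n. x (Suc n) = A n *v x n"
    and x: "\<And>n i. 0 \<le> x n $ i" "\<And>n i. x n $ i \<le> 1" and uv: "u \<le> 1" "0 \<le> v"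
    and S: "\<And>i. i \<in> S \<Longrightarrow> u \<le> x 0 $ i" "\<And>i. i \<notin> S \<Longrightarrow> x 0 $ i \<le> v"
  shows "i \<in> S \<Longrightarrow> u - (\<Sum>k<n. flow (A k) S) \<le> x n $ i"
    and "i \<notin> S \<Longrightarrow> x n $ i \<le> v + (\<Sum>k<n. flow (A k) S)"
proof (induction n arbitrary: i)
  case 0
  { case 1 then show ?case using S by simp }
  { case 2 then show ?case using S by simp }
next
  case (Suc n)
  define F where "F = (\<Sum>k<n. flow (A k) S)"
  have F: "0 \<le> F"
    unfolding F_def by (intro sum_nonneg flow_nonneg A)
  { case 1
    have "u - F - flow (A n) S \<le> (A n *v x n) $ i"
      by (rule stochastic_mult_separation[OF A x]) (use Suc(1) F uv 1 in \<open>auto simp: F_def\<close>)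
    then show ?case by (simp add: step F_def)
  }
  { case 2
    \<comment> \<open>The upper bound off \<open>S\<close> is the lower bound for the reflected
      state \<open>1 - x n\<close> on \<open>- S\<close>. Reflection commutes with
      \<open>A n\<close> because rows sum to 1, and the flow is the same for both sides of the
      cut.\<close>
    have "(1 - v - F) - flow (A n) (- S) \<le> (A n *v (1 - x n)) $ i"
      by (rule stochastic_mult_separation[OF A])
        (use Suc(2) F uv x 2 in \<open>auto simp: F_def algebra_simps\<close>)
    moreover have "(A n *v (1 - x n)) $ i = 1 - (A n *v x n) $ i"
      using A[of n] by (simp add: matrix_vector_mult_def stochastic_def algebra_simps sum_subtractf)
    ultimately show ?case by (simp add: step F_def flow_Compl)
  }
qed

lemma dynamics_shift_Suc:
  "dynamics A t0 x0 (t0 + Suc n) = A (t0 + n) *v dynamics A t0 x0 (t0 + n)"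
  by simp

lemma dynamics_initial: "dynamics A t0 x0 t0 = x0"
  by (cases t0) auto

lemma dynamics_unit_interval:
  assumes "\<And>k. stochastic (A k)" "\<And>i. 0 \<le> x0 $ i" "\<And>i. x0 $ i \<le> 1"
  shows "0 \<le> dynamics A t0 x0 k $ i" "dynamics A t0 x0 k $ i \<le> 1"
proof (induction k arbitrary: i)
  case (Suc k)
  { case 1 then show ?case using assms Suc stochastic_mult_ge[of "A k" 0 "dynamics A t0 x0 k"] by auto }
  { case 2 then show ?case using assms Suc stochastic_mult_le[of "A k" "dynamics A t0 x0 k" 1] by auto }
qed (use assms in auto)

text \<open>If the flow across \<open>S\<close> were summable, then, started late enough at the indicator of \<open>S\<close>,
  the states in \<open>S\<close> would stay above \<open>3/4\<close> and those outside below \<open>1/4\<close>.\<close>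

lemma ergodic_imp_infinite_flow:
  assumes A: "\<And>k. stochastic (A k)" and erg: "ergodic_chain A"
  shows "infinite_flow_chain A"
  unfolding infinite_flow_chain_iff[OF A]
proof (intro allI impI notI)
  fix S :: "'a set"
  assume S: "S \<noteq> {} \<and> S \<noteq> UNIV" and sm: "summable (\<lambda>k. flow (A k) S)"
  obtain i j where ij: "i \<in> S" "j \<notin> S" using S by auto
  obtain T where T: "\<And>n. norm (\<Sum>k. flow (A (k + T)) S) < 1/4"
    using suminf_exist_split[OF _ sm, of "1/4"] by auto
  define x0 :: "real^'a" where "x0 = (\<chi> i. if i \<in> S then 1 else 0)"
  define x where "x n = dynamics A T x0 (T + n)" for n
  have x01: "0 \<le> x n $ i" "x n $ i \<le> 1" for n i
    unfolding x_def by (rule dynamics_unit_interval[OF A]; simp add: x0_def)+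
  have F: "(\<Sum>k<n. flow (A (T + k)) S) \<le> 1/4" for n
  proof -
    have "(\<Sum>k<n. flow (A (k + T)) S) \<le> (\<Sum>k. flow (A (k + T)) S)"
      by (rule sum_le_suminf) (use sm flow_nonneg[OF A] in \<open>auto simp: summable_iff_shift[of "\<lambda>k. flow (A k) S"]\<close>)
    with T show ?thesis by (simp add: add.commute)
  qed
  have step: "x (Suc n) = A (T + n) *v x n" for n
    unfolding x_def by (rule dynamics_shift_Suc)
  have "1 - (\<Sum>k<n. flow (A (T + k)) S) \<le> x n $ i" 
      "x n $ j \<le> 0 + (\<Sum>k<n. flow (A (T + k)) S)" for n
    by (rule separation_drift[of "\<lambda>n. A (T + n)" x, OF A step x01];
      use ij in \<open>auto simp: x_def dynamics_initial x0_def\<close>)+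
  note sep = this
  have ge: "1/2 \<le> x n $ i - x n $ j" for n
    using F[of n] sep[of n] by linarith
  have "(\<lambda>k. dynamics A T x0 k $ i - dynamics A T x0 k $ j) \<longlonglongrightarrow> 0"
    using erg unfolding ergodic_chain_def by blast
  then have "(\<lambda>n. x n $ i - x n $ j) \<longlonglongrightarrow> 0"
    using LIMSEQ_ignore_initial_segment[of _ 0 T] unfolding x_def by (simp add: add.commute)
  then have "1/2 \<le> (0::real)"
    by (rule LIMSEQ_le_const) (use ge in auto)
  then show False by simp
qed

text \<open>Pigeonhole: cut the interval of length \<open>D\<close> above \<open>x $ q\<close> into
  \<open>CARD('m)\<close> equal cells, open on the left. Since \<open>q\<close> lies in none of
  them, the other states cannot fill all cells; \<open>S\<close> collects the states above an empty
  one.\<close>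

lemma exists_gap:
  fixes x :: "real^'m::finite"
  assumes D: "0 < D" "D \<le> x $ p - x $ q"
  obtains S u where "p \<in> S" "q \<notin> S"
    "\<And>i. i \<in> S \<Longrightarrow> u + D / CARD('m) \<le> x $ i" "\<And>i. i \<notin> S \<Longrightarrow> x $ i \<le> u"
proof -
  define m where "m = CARD('m)"
  have m: "m > 0" unfolding m_def by simp
  define g where "g = D / m"
  have g: "g > 0" unfolding g_def using D m by simp
  \<comment> \<open>This is the index of the cell containing \<open>x $ i\<close>. States not above
    \<open>x $ q\<close> get the value 0 through \<open>nat\<close>; this is harmless, since only
    the fact that a state in cell \<open>l\<close> has index \<open>l\<close> matters.\<close>
  define b where "b i = nat (\<lceil>(x $ i - x $ q) / g\<rceil> - 1)" for i
  have "\<not> {..<m} \<subseteq> b ` (UNIV - {q})"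
  proof
    assume "{..<m} \<subseteq> b ` (UNIV - {q})"
    then have "m \<le> card (b ` (UNIV - {q}))"
      using card_mono[of "b ` (UNIV - {q})" "{..<m}"] by simp
    also have "\<dots> \<le> card (UNIV - {q})" by (rule card_image_le) simp
    also have "\<dots> < m" using m by (simp add: m_def card_Diff_singleton)
    finally show False by simp
  qed
  then obtain l where l: "l < m" "\<And>i. i \<noteq> q \<Longrightarrow> b i \<noteq> l" by auto
  define S where "S = {i. x $ i > x $ q + l * g}"
  have above: "x $ q + l * g + g \<le> x $ i" if "i \<in> S" for i
  proof (rule ccontr)
    assume "\<not> x $ q + l * g + g \<le> x $ i"
    then have "real l < (x $ i - x $ q) / g" "(x $ i - x $ q) / g \<le> real l + 1"
      using that g by (auto simp: S_def field_simps)
    then have "\<lceil>(x $ i - x $ q) / g\<rceil> = int l + 1" by linarith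
    then have "b i = l" by (simp add: b_def)
    moreover have "i \<noteq> q" using that g by (auto simp: S_def mult_less_0_iff)
    ultimately show False using l by auto
  qed
  have "l * g < m * g" using l(1) g by simp
  also have "m * g = D" using m by (simp add: g_def)
  finally have "p \<in> S" using D by (simp add: S_def)
  moreover have "q \<notin> S" using g by (simp add: S_def mult_less_0_iff)
  ultimately show ?thesis
    using that[of S "x $ q + l * g"] above by (auto simp: S_def g_def m_def)
qed

text \<open>While \<open>S\<close> and its complement are separated by \<open>g / 2\<close>, the flow across \<open>S\<close> costs at least
  \<open>(g / 2)\<^sup>2\<close> per unit in the summable series, and the gap can only close through that flow. With a
  tail below \<open>g ^ 3 / 16\<close> the total flow is thus at most \<open>g / 4\<close>, which never closes the gap.\<close>

lemma gap_persists:
  assumes A: "\<And>k. stochastic (A k)" and step: "\<And>n. x (Suc n) = A n *v x n"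
    and x: "\<And>n i. 0 \<le> x n $ i" "\<And>n i. x n $ i \<le> 1"
    and S: "S \<noteq> {}" "S \<noteq> UNIV" and g: "0 < g"
    and gap: "\<And>i. i \<in> S \<Longrightarrow> u + g \<le> x 0 $ i" "\<And>i. i \<notin> S \<Longrightarrow> x 0 $ i \<le> u"
    and cost: "\<And>n. (\<Sum>k<n. \<Sum>i\<in>UNIV. \<Sum>j\<in>UNIV.
      (A k $ i $ j + A k $ j $ i) * (x k $ i - x k $ j)\<^sup>2) \<le> g ^ 3 / 16"
  shows "summable (\<lambda>k. flow (A k) S)"
proof -
  define Q where "Q k = (\<Sum>i\<in>UNIV. \<Sum>j\<in>UNIV.
      (A k $ i $ j + A k $ j $ i) * (x k $ i - x k $ j)\<^sup>2)" for k
  define F where "F n = (\<Sum>k<n. flow (A k) S)" for n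
  have nn: "0 \<le> A k $ i $ j" for k i j
    using A by (simp add: stochastic_def)
  have u: "u + g \<le> 1" "0 \<le> u"
    using S gap x by (meson ex_in_conv order_trans, metis UNIV_eq_I gap(2) order_trans x(1))
  have drift: "i \<in> S \<Longrightarrow> (u + g) - F n \<le> x n $ i" "i \<notin> S \<Longrightarrow> x n $ i \<le> u + F n" for n i
    unfolding F_def by (rule separation_drift[where A = A and x = x, OF A step x u]; use gap in auto)+
  \<comment> \<open>The cost bound is \<open>(g / 4) * (g / 2)\<^sup>2\<close>. The induction below
    needs this implication at each \<open>n\<close>: total flow at most \<open>g / 4\<close> leaves
    a separation of at least \<open>g - 2 * (g / 4) = g / 2\<close> for the next step.\<close>
  have le: "F n \<le> g / 4" if "F n * (g / 2)\<^sup>2 \<le> (\<Sum>k<n. Q k)" for n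
  proof -
    have "(\<Sum>k<n. Q k) \<le> (g / 4) * (g / 2)\<^sup>2"
      using cost[of n] unfolding Q_def[symmetric] by (simp add: power2_eq_square power3_eq_cube)
    with that have "F n * (g / 2)\<^sup>2 \<le> (g / 4) * (g / 2)\<^sup>2" by (rule order_trans)
    then show ?thesis using g by (simp add: power2_eq_square)
  qed
  have "F n * (g / 2)\<^sup>2 \<le> (\<Sum>k<n. Q k)" for n
  proof (induction n)
    case 0
    then show ?case by (simp add: F_def)
  next
    case (Suc n)
    have sep: "(g / 2)\<^sup>2 \<le> (x n $ i - x n $ j)\<^sup>2" if "i \<in> S" "j \<in> - S" for i j
      using drift(1)[of i n] drift(2)[of j n] le[OF Suc] that g by (intro power_mono) auto
    have "flow (A n) S * (g / 2)\<^sup>2 = (\<Sum>i\<in>S. \<Sum>j\<in>- S. (A n $ i $ j + A n $ j $ i) * (g / 2)\<^sup>2)"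
      by (simp add: flow_def sum_distrib_right)
    also have "\<dots> \<le> (\<Sum>i\<in>S. \<Sum>j\<in>- S. (A n $ i $ j + A n $ j $ i) * (x n $ i - x n $ j)\<^sup>2)"
      by (intro sum_mono mult_left_mono sep) (auto simp: nn)
    also have "\<dots> \<le> (\<Sum>i\<in>S. \<Sum>j\<in>UNIV. (A n $ i $ j + A n $ j $ i) * (x n $ i - x n $ j)\<^sup>2)"
      by (intro sum_mono sum_mono2) (auto simp: nn)
    also have "\<dots> \<le> Q n"
      unfolding Q_def by (intro sum_mono2) (auto simp: nn intro!: sum_nonneg)
    finally show ?case
      using Suc by (simp add: F_def algebra_simps)
  qed
  then have "F n \<le> g / 4" for n using le by blast
  then show ?thesis
    unfolding F_def by (intro summableI_nonneg_bounded[of _ "g / 4"] flow_nonneg A)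
qed

text \<open>It suffices that the spread falls below every \<open>D > 0\<close> once: averaging keeps
  all later states between the minimum and maximum reached at that time.\<close>

lemma trajectory_consensus:
  fixes x :: "nat \<Rightarrow> real^'m::finite"
  assumes A: "\<And>k. stochastic (A k)" and step: "\<And>n. x (Suc n) = A n *v x n"
    and x: "\<And>n i. 0 \<le> x n $ i" "\<And>n i. x n $ i \<le> 1"
    and flow: "\<And>S. S \<noteq> {} \<Longrightarrow> S \<noteq> UNIV \<Longrightarrow> \<not> summable (\<lambda>k. flow (A k) S)"
    and sm: "\<And>i j. summable (\<lambda>k. A k $ i $ j * (x k $ i - x k $ j)\<^sup>2)"
  shows "(\<lambda>n. x n $ i - x n $ j) \<longlonglongrightarrow> 0"
proof -
  have close: "\<exists>T. \<forall>p q. x T $ p - x T $ q < D" if D: "D > 0" for D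
  proof (rule ccontr)
    assume "\<nexists>T. \<forall>p q. x T $ p - x T $ q < D"
    then have far: "\<exists>p q. D \<le> x T $ p - x T $ q" for T by (meson not_le)
    define Q where "Q k = (\<Sum>i\<in>UNIV. \<Sum>j\<in>UNIV.
      (A k $ i $ j + A k $ j $ i) * (x k $ i - x k $ j)\<^sup>2)" for k
    have "summable (\<lambda>k. (A k $ i $ j + A k $ j $ i) * (x k $ i - x k $ j)\<^sup>2)" for i j
      using summable_add[OF sm[of i j] sm[of j i]]
      by (simp add: algebra_simps power2_commute[of "x _ $ j"])
    then have smQ: "summable Q" unfolding Q_def by (intro summable_sum)
    have Q0: "0 \<le> Q k" for k
      using A[of k] unfolding Q_def stochastic_def by (intro sum_nonneg mult_nonneg_nonneg) auto
    define g where "g = D / CARD('m)"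
    have g: "g > 0" unfolding g_def using D by simp
    \<comment> \<open>The guaranteed gap \<open>g\<close> depends only on \<open>D\<close>, so
      \<open>T\<close> can be fixed before the cut \<open>S\<close>, which is then read off the
      state at time \<open>T\<close>.\<close>
    obtain T where T: "norm (\<Sum>k. Q (k + T)) < g ^ 3 / 16"
      using suminf_exist_split[OF _ smQ, of "g ^ 3 / 16"] g by auto
    have cost: "(\<Sum>k<n. Q (T + k)) \<le> g ^ 3 / 16" for n
    proof -
      have "(\<Sum>k<n. Q (k + T)) \<le> (\<Sum>k. Q (k + T))"
        by (rule sum_le_suminf) (use smQ Q0 in \<open>auto simp: summable_iff_shift\<close>)
      with T show ?thesis by (simp add: add.commute)
    qed
    obtain p q where pq: "D \<le> x T $ p - x T $ q" using far by blast
    from exists_gap[OF D pq] obtain S u where S: "p \<in> S" "q \<notin> S"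
      "\<And>i. i \<in> S \<Longrightarrow> u + g \<le> x T $ i" "\<And>i. i \<notin> S \<Longrightarrow> x T $ i \<le> u"
      unfolding g_def by blast
    have "summable (\<lambda>k. flow (A (T + k)) S)"
      by (rule gap_persists[where x = "\<lambda>n. x (T + n)" and g = g and u = u])
        (use S A step x g cost in \<open>auto simp: Q_def\<close>)
    then have "summable (\<lambda>k. flow (A k) S)"
      by (subst (asm) add.commute) (simp add: summable_iff_shift[of "\<lambda>k. flow (A k) S"])
    then show False using flow S by blast
  qed
  show ?thesis
  proof (rule LIMSEQ_I)
    fix r :: real assume "0 < r"
    then obtain T where T: "\<And>p q. x T $ p - x T $ q < r" using close by blast
    define a where "a = Min (range (\<lambda>i. x T $ i))"
    define b where "b = Max (range (\<lambda>i. x T $ i))"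
    have inv: "a \<le> x (T + n) $ i \<and> x (T + n) $ i \<le> b" for n i
    proof (induction n arbitrary: i)
      case 0 then show ?case by (auto simp: a_def b_def)
    next
      case (Suc n)
      then show ?case
        using stochastic_mult_ge[OF A, of a "x (T + n)"] stochastic_mult_le[OF A, of "x (T + n)" b]
        by (simp add: step)
    qed
    have "a \<in> range (\<lambda>i. x T $ i)" "b \<in> range (\<lambda>i. x T $ i)"
      unfolding a_def b_def by (intro Min_in Max_in; simp)+
    then have ab: "b - a < r" using T by auto
    show "\<exists>no. \<forall>n\<ge>no. norm (x n $ i - x n $ j - 0) < r"
    proof (intro exI allI impI)
      fix n assume "T \<le> n"
      then obtain d where d: "n = T + d" using le_Suc_ex by blast
      show "norm (x n $ i - x n $ j - 0) < r"
        using inv[of d i] inv[of d j] ab by (simp add: d abs_less_iff)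
    qed
  qed
qed

section \<open>Linearity in the initial state\<close>

lemma linear_dynamics: "linear (\<lambda>x. dynamics A t0 x k)"
proof (induction k)
  case (Suc k)
  then show ?case
    using linear_compose[OF Suc matrix_vector_mul_linear[of "A k"]]
    by (cases "t0 \<le> k") (auto simp: o_def linear_id[unfolded id_def])
qed (simp add: linear_id[unfolded id_def])

text \<open>Ergodicity quantifies over uncountably many initial states, while almost sure statements
  combine only countably. Linearity leaves finitely many basis vectors.\<close>

lemma ergodic_chain_axisI:
  assumes "\<And>t0 l i j. (\<lambda>k. dynamics A t0 (axis l 1) k $ i - dynamics A t0 (axis l 1) k $ j) \<longlonglongrightarrow> 0"
  shows "ergodic_chain A"
  unfolding ergodic_chain_def
proof (intro allI)
  fix t0 x0 i j
  have exp: "dynamics A t0 x0 k = (\<Sum>l\<in>UNIV. x0 $ l *\<^sub>R dynamics A t0 (axis l 1) k)" for k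
  proof -
    have "dynamics A t0 x0 k = dynamics A t0 (\<Sum>l\<in>UNIV. x0 $ l *\<^sub>R axis l 1) k"
      using basis_expansion[of x0] by (simp add: scalar_mult_eq_scaleR)
    also have "\<dots> = (\<Sum>l\<in>UNIV. x0 $ l *\<^sub>R dynamics A t0 (axis l 1) k)"
      by (simp add: linear_sum[OF linear_dynamics] linear_cmul[OF linear_dynamics])
    finally show ?thesis .
  qed
  have "(\<lambda>k. \<Sum>l\<in>UNIV. x0 $ l * (dynamics A t0 (axis l 1) k $ i - dynamics A t0 (axis l 1) k $ j))
      \<longlonglongrightarrow> (\<Sum>l\<in>UNIV. x0 $ l * 0)"
    by (intro tendsto_intros assms)
  then show "(\<lambda>k. dynamics A t0 x0 k $ i - dynamics A t0 x0 k $ j) \<longlonglongrightarrow> 0"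
    by (simp add: exp sum_subtractf right_diff_distrib)
qed

section \<open>Sums of independent bounded variables\<close>

text \<open>By monotone convergence the expectation of the whole series is the sum of the
  expectations. It is finite, so the series is finite almost surely.\<close>

lemma (in prob_space) AE_summable:
  fixes X :: "nat \<Rightarrow> 'a \<Rightarrow> real"
  assumes int: "\<And>k. integrable M (X k)" and nn: "\<And>k \<omega>. \<omega> \<in> space M \<Longrightarrow> 0 \<le> X k \<omega>"
    and sm: "summable (\<lambda>k. expectation (X k))"
  shows "AE \<omega> in M. summable (\<lambda>k. X k \<omega>)"
proof -
  have [measurable]: "X k \<in> borel_measurable M" for k
    using int by auto
  have "(\<integral>\<^sup>+\<omega>. (\<Sum>k. ennreal (X k \<omega>)) \<partial>M) = (\<Sum>k. \<integral>\<^sup>+\<omega>. ennreal (X k \<omega>) \<partial>M)"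
    by (rule nn_integral_suminf) simp
  also have "\<dots> = (\<Sum>k. ennreal (expectation (X k)))"
    using nn by (intro suminf_cong nn_integral_eq_integral int) auto
  also have "\<dots> \<noteq> \<infinity>"
    unfolding infinity_ennreal_def
    by (rule ennreal_suminf_neq_top[OF sm]) (use nn in \<open>auto intro!: integral_nonneg_AE\<close>)
  finally have "AE \<omega> in M. (\<Sum>k. ennreal (X k \<omega>)) \<noteq> \<infinity>"
    by (intro nn_integral_PInf_AE) auto
  then show ?thesis
    using AE_space
  proof eventually_elim
    case (elim \<omega>)
    then show ?case
      using summable_suminf_not_top[of "\<lambda>k. X k \<omega>"] nn by auto
  qed
qed

text \<open>A bound linear in \<open>x\<close> survives taking expectations. It comes from
  \<open>1 + x \<le> exp x\<close> and the identity
  \<open>1 / (1 + x) = 1 - x / (1 + x)\<close>.\<close>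

lemma exp_minus_le_linear:
  fixes x :: real
  assumes "0 \<le> x" "x \<le> C"
  shows "exp (- x) \<le> 1 - x / (1 + C)"
proof -
  have "exp (- x) \<le> 1 / (1 + x)"
    using exp_ge_add_one_self[of x] assms by (simp add: exp_minus field_simps)
  also have "\<dots> = 1 - x / (1 + x)" using assms by (simp add: field_simps)
  also have "\<dots> \<le> 1 - x / (1 + C)" using assms by (simp add: frac_le)
  finally show ?thesis .
qed

text \<open>The expectation of \<open>exp (- X\<^sub>0 - \<dots> - X\<^sub>n)\<close> factors by independence and is bounded by
  \<open>exp (- (E X\<^sub>0 + \<dots> + E X\<^sub>n) / (1 + C))\<close>, which tends to \<open>0\<close>.\<close>

lemma (in prob_space) AE_not_summable:
  fixes X :: "nat \<Rightarrow> 'a \<Rightarrow> real"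
  assumes ind: "indep_vars (\<lambda>_. borel) X UNIV"
    and X: "\<And>k \<omega>. \<omega> \<in> space M \<Longrightarrow> 0 \<le> X k \<omega>" "\<And>k \<omega>. \<omega> \<in> space M \<Longrightarrow> X k \<omega> \<le> C"
    and nsm: "\<not> summable (\<lambda>k. expectation (X k))"
  shows "AE \<omega> in M. \<not> summable (\<lambda>k. X k \<omega>)"
proof -
  have [measurable]: "X k \<in> borel_measurable M" for k
    using ind by (auto simp: indep_vars_def)
  have int: "integrable M (X k)" for k
    by (rule integrable_const_bound[of _ C]) (use X in auto)
  obtain \<omega>0 where "\<omega>0 \<in> space M" using not_empty by blast
  then have C: "0 \<le> C" using X order_trans by blast
  define e where "e k = expectation (X k)" for k
  have e0: "0 \<le> e k" for k
    unfolding e_def by (rule integral_nonneg_AE) (use X in auto)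
  define P where "P n \<omega> = exp (- (\<Sum>k<n. X k \<omega>))" for n \<omega>
  have [measurable]: "P n \<in> borel_measurable M" for n
    unfolding P_def by measurable
  have intexp: "integrable M (\<lambda>\<omega>. exp (- X k \<omega>))" for k
    by (rule integrable_const_bound[of _ 1]) (use X in auto)
  have P_int: "integrable M (P n)" for n
    by (rule integrable_const_bound[of _ 1]) (use X in \<open>auto simp: P_def sum_nonneg\<close>)
  have P_le: "expectation (P n) \<le> exp (- (\<Sum>k<n. e k) / (1 + C))" for n
  proof -
    have "expectation (P n) = expectation (\<lambda>\<omega>. \<Prod>k<n. exp (- X k \<omega>))"
      unfolding P_def sum_negf[symmetric] exp_sum[OF finite_lessThan] ..
    also have "\<dots> = (\<Prod>k<n. expectation (\<lambda>\<omega>. exp (- X k \<omega>)))"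
    proof (rule indep_vars_lebesgue_integral)
      show "indep_vars (\<lambda>_. borel) (\<lambda>k \<omega>. exp (- X k \<omega>)) {..<n}"
        by (rule indep_vars_compose2[OF indep_vars_subset[OF ind]]) auto
    qed (use intexp in auto)
    also have "\<dots> \<le> (\<Prod>k<n. exp (- e k / (1 + C)))"
    proof (rule prod_mono, safe)
      fix k
      show "0 \<le> expectation (\<lambda>\<omega>. exp (- X k \<omega>))" by simp
      have "expectation (\<lambda>\<omega>. exp (- X k \<omega>)) \<le> expectation (\<lambda>\<omega>. 1 - X k \<omega> / (1 + C))"
        by (rule integral_mono) (use intexp int X exp_minus_le_linear in auto)
      also have "\<dots> = 1 - e k / (1 + C)"
        using int by (simp add: e_def prob_space)
      also have "\<dots> \<le> exp (- e k / (1 + C))"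
        using exp_ge_add_one_self[of "- e k / (1 + C)"] by simp
      finally show "expectation (\<lambda>\<omega>. exp (- X k \<omega>)) \<le> exp (- e k / (1 + C))" .
    qed
    also have "\<dots> = exp (- (\<Sum>k<n. e k) / (1 + C))"
      by (simp add: exp_sum[symmetric] sum_negf flip: sum_divide_distrib)
    finally show ?thesis .
  qed
  \<comment> \<open>On the sample space \<open>Z\<close> is \<open>exp\<close> of minus the full
    series, read as 0 when the series diverges. It lies below every \<open>P n\<close>, so its
    expectation vanishes.\<close>
  define Z where "Z \<omega> = (INF n. ennreal (P n \<omega>))" for \<omega>
  have [measurable]: "Z \<in> borel_measurable M"
    unfolding Z_def by measurable
  have "(\<integral>\<^sup>+\<omega>. Z \<omega> \<partial>M) \<le> ennreal \<epsilon>" if \<epsilon>: "\<epsilon> > 0" for \<epsilon> :: real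
  proof -
    \<comment> \<open>This threshold is what makes the bound in \<open>P_le\<close> at most
      \<open>\<epsilon>\<close>; it is exceeded because the partial sums of \<open>e\<close> are
      unbounded.\<close>
    have "\<exists>n. - ln \<epsilon> * (1 + C) < (\<Sum>k<n. e k)"
    proof (rule ccontr)
      assume "\<nexists>n. - ln \<epsilon> * (1 + C) < (\<Sum>k<n. e k)"
      then have "summable e"
        using e0 by (intro summableI_nonneg_bounded[of _ "- ln \<epsilon> * (1 + C)"]) (auto simp: not_less)
      then show False using nsm by (simp add: e_def[abs_def])
    qed
    then obtain n where n: "- ln \<epsilon> * (1 + C) < (\<Sum>k<n. e k)" by blast
    have "- (\<Sum>k<n. e k) / (1 + C) \<le> ln \<epsilon>"
      using n C by (simp add: field_simps)
    then have "expectation (P n) \<le> \<epsilon>"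
      using P_le[of n] \<epsilon> by (smt (verit) exp_ln exp_le_cancel_iff)
    have "(\<integral>\<^sup>+\<omega>. Z \<omega> \<partial>M) \<le> (\<integral>\<^sup>+\<omega>. ennreal (P n \<omega>) \<partial>M)"
      unfolding Z_def by (intro nn_integral_mono INF_lower) simp
    also have "\<dots> = ennreal (expectation (P n))"
      by (rule nn_integral_eq_integral[OF P_int]) (simp add: P_def)
    also have "\<dots> \<le> ennreal \<epsilon>" using \<open>expectation (P n) \<le> \<epsilon>\<close> by (rule ennreal_leI)
    finally show ?thesis .
  qed
  then have "(\<integral>\<^sup>+\<omega>. Z \<omega> \<partial>M) = 0"
    using ennreal_le_epsilon[of 0 "\<integral>\<^sup>+\<omega>. Z \<omega> \<partial>M"] by simp
  then have "AE \<omega> in M. Z \<omega> = 0"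
    by (simp add: nn_integral_0_iff_AE)
  then show ?thesis
    using AE_space
  proof eventually_elim
    case (elim \<omega>)
    show ?case
    proof
      assume sm: "summable (\<lambda>k. X k \<omega>)"
      have "ennreal (exp (- (\<Sum>k. X k \<omega>))) \<le> Z \<omega>"
        unfolding Z_def P_def
        by (intro INF_greatest ennreal_leI) (use sm X elim in \<open>auto intro!: sum_le_suminf\<close>)
      then show False using elim by simp
    qed
  qed
qed

section \<open>Random models\<close>

text \<open>Expanding \<open>f\<close> in matrix units makes the matrix-valued function integrable.
  Taking an entry is bounded linear and therefore commutes with the integral.\<close>

lemma integral_matrix:
  fixes f :: "'w \<Rightarrow> real^'n::finite^'m::finite"
  assumes "\<And>i j. integrable M (\<lambda>\<omega>. f \<omega> $ i $ j)"
  shows "(\<integral>\<omega>. f \<omega> \<partial>M) $ i $ j = (\<integral>\<omega>. f \<omega> $ i $ j \<partial>M)"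
proof -
  have "f \<omega> = (\<Sum>i\<in>UNIV. \<Sum>j\<in>UNIV. f \<omega> $ i $ j *\<^sub>R axis i (axis j 1))" for \<omega>
  proof -
    have "(\<Sum>i\<in>UNIV. \<Sum>j\<in>UNIV. f \<omega> $ i $ j *\<^sub>R axis i (axis j 1)) $ p $ q =
      (\<Sum>i\<in>UNIV. \<Sum>j\<in>UNIV. if i = p then if j = q then f \<omega> $ i $ j else 0 else 0)" for p q
      unfolding sum_component by (intro sum.cong refl) (auto simp: axis_def)
    also have "\<dots> p q = f \<omega> $ p $ q" for p q
    proof -
      have "(\<Sum>i\<in>UNIV. \<Sum>j\<in>UNIV. if i = p then if j = q then f \<omega> $ i $ j else 0 else 0) =
        (\<Sum>i\<in>UNIV. if i = p then f \<omega> $ i $ q else 0)"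
        by (intro sum.cong refl) auto
      then show ?thesis by simp
    qed
    finally show ?thesis by (simp add: vec_eq_iff)
  qed
  then have "f = (\<lambda>\<omega>. \<Sum>i\<in>UNIV. \<Sum>j\<in>UNIV. f \<omega> $ i $ j *\<^sub>R axis i (axis j 1))" ..
  moreover have "integrable M \<dots>"
    by (intro Bochner_Integration.integrable_sum integrable_scaleR_left assms)
  ultimately have "integrable M f" by simp
  then show ?thesis
    by (intro integral_bounded_linear[symmetric]
        bounded_linear_compose[OF bounded_linear_vec_nth bounded_linear_vec_nth])
qed

section \<open>Measurability of entries and states\<close>

lemma borel_measurable_matrix_nth [measurable (raw)]:
  fixes f :: "'w \<Rightarrow> real^'n::finite^'m::finite"
  shows "f \<in> borel_measurable M \<Longrightarrow> (\<lambda>\<omega>. f \<omega> $ i $ j) \<in> borel_measurable M"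
  by (rule borel_measurable_continuous_on[of "\<lambda>A. A $ i $ j"]) (intro continuous_intros)

lemma borel_measurable_vector_nth [measurable (raw)]:
  fixes f :: "'w \<Rightarrow> real^'n::finite"
  shows "f \<in> borel_measurable M \<Longrightarrow> (\<lambda>\<omega>. f \<omega> $ i) \<in> borel_measurable M"
  by (rule borel_measurable_continuous_on[of "\<lambda>x. x $ i"]) (intro continuous_intros)

lemma borel_measurable_matrix_vector_mult [measurable (raw)]:
  fixes f :: "'w \<Rightarrow> real^'n::finite^'m::finite"
  assumes "f \<in> borel_measurable M" "g \<in> borel_measurable M"
  shows "(\<lambda>\<omega>. f \<omega> *v g \<omega>) \<in> borel_measurable M"
  by (rule borel_measurable_continuous_Pair[OF assms])
    (unfold matrix_vector_mult_def, intro continuous_intros)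

text \<open>Requiring only the matrices before time \<open>k\<close>, over an arbitrary
  \<open>N\<close>, lets \<open>N\<close> be the product space over \<open>{..<k}\<close> in the
  independence argument.\<close>

lemma borel_measurable_dynamics:
  assumes "\<And>i. i < k \<Longrightarrow> A i \<in> borel_measurable N"
  shows "(\<lambda>\<omega>. dynamics (\<lambda>i. A i \<omega>) t0 x0 k) \<in> borel_measurable N"
  using assms
proof (induction k)
  case (Suc k)
  then have [measurable]: "(\<lambda>\<omega>. dynamics (\<lambda>i. A i \<omega>) t0 x0 k) \<in> borel_measurable N"
    "A k \<in> borel_measurable N" by auto
  show ?case by (cases "t0 \<le> k") auto
qed simp

lemma dynamics_cong:
  "(\<And>i. i < k \<Longrightarrow> A i = B i) \<Longrightarrow> dynamics A t0 x0 k = dynamics B t0 x0 k"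
  by (induction k) auto

lemma stochastic_entry:
  assumes "stochastic A"
  shows "0 \<le> A $ i $ j" "A $ i $ j \<le> 1"
proof -
  have nn: "0 \<le> A $ i $ j" for i j using assms by (simp add: stochastic_def)
  then show "0 \<le> A $ i $ j" .
  have "A $ i $ j \<le> (\<Sum>j\<in>UNIV. A $ i $ j)"
    by (rule member_le_sum) (auto simp: nn)
  then show "A $ i $ j \<le> 1" using assms by (simp add: stochastic_def)
qed

text \<open>Provides the uniform constant \<open>C\<close> for
  \<open>AE_not_summable\<close>.\<close>

lemma stochastic_flow_le: "stochastic A \<Longrightarrow> flow A S \<le> (\<Sum>i\<in>S. \<Sum>j\<in>- S. 2)"
  unfolding flow_def by (intro sum_mono) (smt (verit) stochastic_entry)

lemma random_model_prob_space: "random_model M W \<Longrightarrow> prob_space M"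
  by (simp add: random_model_def)

section \<open>A random model and its expected chain\<close>

context
  fixes M :: "'w measure" and W :: "nat \<Rightarrow> 'w \<Rightarrow> real^'m::finite^'m"
  assumes model: "random_model M W"
begin

interpretation prob_space M
  by (rule random_model_prob_space[OF model])

lemma model_measurable [measurable]: "W k \<in> borel_measurable M"
  using model by (simp add: random_model_def)

lemma model_stochastic: "\<omega> \<in> space M \<Longrightarrow> stochastic (W k \<omega>)"
  using model by (simp add: random_model_def)

lemma integrable_entry: "integrable M (\<lambda>\<omega>. W k \<omega> $ i $ j)"
  by (rule integrable_const_bound[of _ 1])
    (auto simp: stochastic_entry[OF model_stochastic])

lemma expected_model_nth: "expected_model M W k $ i $ j = expectation (\<lambda>\<omega>. W k \<omega> $ i $ j)"
  unfolding expected_model_def by (rule integral_matrix) (rule integrable_entry)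

text \<open>Links the two hypotheses of the theorem: the weights in the class condition are the
  quantities that weak feedback bounds from below.\<close>

lemma second_moment_nth:
  "second_moment M W k $ i $ j = expectation (\<lambda>\<omega>. column i (W k \<omega>) \<bullet> column j (W k \<omega>))"
proof -
  have eq: "(transpose A ** A) $ i $ j = (\<Sum>l\<in>UNIV. A $ l $ i * A $ l $ j)"
    for A :: "real^'m^'m" and i j
    by (simp add: matrix_matrix_mult_def transpose_def)
  have "integrable M (\<lambda>\<omega>. W k \<omega> $ l $ i * W k \<omega> $ l $ j)" for l i j
    by (rule integrable_const_bound[of _ 1])
      (auto simp: stochastic_entry[OF model_stochastic] intro!: mult_le_one)
  then have "second_moment M W k $ i $ j = expectation (\<lambda>\<omega>. (transpose (W k \<omega>) ** W k \<omega>) $ i $ j)"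
    unfolding second_moment_def by (intro integral_matrix) (simp add: eq)
  then show ?thesis
    by (simp add: eq inner_vec_def column_def)
qed

lemma stochastic_expected_model: "stochastic (expected_model M W k)"
proof -
  have "(\<Sum>j\<in>UNIV. expectation (\<lambda>\<omega>. W k \<omega> $ i $ j)) = expectation (\<lambda>\<omega>. \<Sum>j\<in>UNIV. W k \<omega> $ i $ j)" for i
    using integrable_entry by simp
  also have "\<dots> i = expectation (\<lambda>\<omega>. 1)" for i
    using model_stochastic by (intro Bochner_Integration.integral_cong) (auto simp: stochastic_def)
  finally show ?thesis
    using stochastic_entry[OF model_stochastic]
    by (auto simp: stochastic_def expected_model_nth prob_space intro!: integral_nonneg_AE)
qed

lemma integrable_flow: "integrable M (\<lambda>\<omega>. flow (W k \<omega>) S)"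
  unfolding flow_def
  by (intro Bochner_Integration.integrable_sum Bochner_Integration.integrable_add integrable_entry)

lemma flow_expected_model: "flow (expected_model M W k) S = expectation (\<lambda>\<omega>. flow (W k \<omega>) S)"
  unfolding flow_def expected_model_nth using integrable_entry by simp

lemma ergodic_model_imp_infinite_flow:
  assumes "ergodic_model M W"
  shows "infinite_flow_model M W"
  using assms AE_space unfolding ergodic_model_def infinite_flow_model_def
  by eventually_elim (auto intro: ergodic_imp_infinite_flow model_stochastic)

lemma infinite_flow_model_imp_expected:
  assumes "infinite_flow_model M W"
  shows "infinite_flow_chain (expected_model M W)"
  unfolding infinite_flow_chain_iff[OF stochastic_expected_model]
proof (intro allI impI notI)
  fix S :: "'m set"
  assume S: "S \<noteq> {} \<and> S \<noteq> UNIV" and sm: "summable (\<lambda>k. flow (expected_model M W k) S)"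
  have "AE \<omega> in M. summable (\<lambda>k. flow (W k \<omega>) S)"
    by (rule AE_summable)
      (use sm integrable_flow in \<open>auto simp: flow_expected_model flow_nonneg model_stochastic\<close>)
  then have "AE \<omega> in M. False"
    using assms[unfolded infinite_flow_model_def] AE_space
  proof eventually_elim
    case (elim \<omega>)
    then show ?case
      using infinite_flow_chain_iff[of "\<lambda>k. W k \<omega>"] S model_stochastic by blast
  qed
  then show False by simp
qed

end

text \<open>The flows across a fixed \<open>S\<close> are functions of the independent matrices and
  uniformly bounded, so \<open>AE_not_summable\<close> applies. Only finitely many \<open>S\<close>
  exist, so the null sets combine.\<close>

lemma expected_imp_infinite_flow_model:
  fixes W :: "nat \<Rightarrow> 'w \<Rightarrow> real^'m::finite^'m"
  assumes ind: "independent_model M W" and flow: "infinite_flow_chain (expected_model M W)"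
  shows "infinite_flow_model M W"
proof -
  have model: "random_model M W" and indep: "prob_space.indep_vars M (\<lambda>_. borel) W UNIV"
    using ind by (auto simp: independent_model_def)
  interpret prob_space M by (rule random_model_prob_space[OF model])
  have "AE \<omega> in M. \<not> summable (\<lambda>k. flow (W k \<omega>) S)" if S: "S \<noteq> {}" "S \<noteq> UNIV" for S
  proof (rule AE_not_summable)
    show "indep_vars (\<lambda>_. borel) (\<lambda>k \<omega>. flow (W k \<omega>) S) UNIV"
      by (rule indep_vars_compose2[OF indep]) (unfold flow_def, measurable)
    show "\<not> summable (\<lambda>k. expectation (\<lambda>\<omega>. flow (W k \<omega>) S))"
      using flow S unfolding infinite_flow_chain_iff[OF stochastic_expected_model[OF model]]
      by (simp add: flow_expected_model[OF model])
  qed (auto intro: flow_nonneg stochastic_flow_le model_stochastic[OF model])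
  then have "AE \<omega> in M. \<forall>S. S \<noteq> {} \<and> S \<noteq> UNIV \<longrightarrow> \<not> summable (\<lambda>k. flow (W k \<omega>) S)"
    unfolding AE_all_countable by auto
  then show ?thesis
    using AE_space unfolding infinite_flow_model_def
  proof eventually_elim
    case (elim \<omega>)
    then show ?case
      using infinite_flow_chain_iff[of "\<lambda>k. W k \<omega>"] model_stochastic[OF model] by blast
  qed
qed

text \<open>The state at time \<open>k\<close> is a function of the matrices with index below
  \<open>k\<close>, hence independent of \<open>W k\<close>.\<close>

lemma expectation_entry_times_state:
  fixes W :: "nat \<Rightarrow> 'w \<Rightarrow> real^'m::finite^'m" and f :: "real^'m \<Rightarrow> real"
  assumes ind: "independent_model M W" and f [measurable]: "f \<in> borel_measurable borel"
    and int: "integrable M (\<lambda>\<omega>. f (dynamics (\<lambda>k. W k \<omega>) t0 x0 k))"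
  shows "(\<integral>\<omega>. W k \<omega> $ i $ j * f (dynamics (\<lambda>k. W k \<omega>) t0 x0 k) \<partial>M) =
      (\<integral>\<omega>. W k \<omega> $ i $ j \<partial>M) * (\<integral>\<omega>. f (dynamics (\<lambda>k. W k \<omega>) t0 x0 k) \<partial>M)" (is ?eq)
    and "integrable M (\<lambda>\<omega>. W k \<omega> $ i $ j * f (dynamics (\<lambda>k. W k \<omega>) t0 x0 k))" (is ?int)
proof -
  have model: "random_model M W" and indep: "prob_space.indep_vars M (\<lambda>_. borel) W UNIV"
    using ind by (auto simp: independent_model_def)
  interpret prob_space M by (rule random_model_prob_space[OF model])
  have [measurable]: "(\<lambda>B. B k) \<in> borel_measurable (PiM {k} (\<lambda>_. borel :: (real^'m^'m) measure))"
    by simp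
  have [measurable]: "(\<lambda>B. dynamics B t0 x0 k) \<in>
      borel_measurable (PiM {..<k} (\<lambda>_. borel :: (real^'m^'m) measure))"
    by (rule borel_measurable_dynamics) simp
  have "indep_var borel ((\<lambda>B. B k $ i $ j) \<circ> (\<lambda>\<omega>. restrict (\<lambda>i. W i \<omega>) {k}))
      borel ((\<lambda>B. f (dynamics B t0 x0 k)) \<circ> (\<lambda>\<omega>. restrict (\<lambda>i. W i \<omega>) {..<k}))"
    by (rule indep_var_compose[OF indep_var_restrict[OF indep]]) auto
  \<comment> \<open>From index \<open>k\<close> on, \<open>restrict\<close> yields
    \<open>undefined\<close>; the state at time \<open>k\<close> never reads those matrices.\<close>
  moreover have "dynamics (restrict (\<lambda>i. W i \<omega>) {..<k}) t0 x0 k = dynamics (\<lambda>i. W i \<omega>) t0 x0 k" for \<omega>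
    by (rule dynamics_cong) simp
  ultimately have "indep_var borel (\<lambda>\<omega>. W k \<omega> $ i $ j)
      borel (\<lambda>\<omega>. f (dynamics (\<lambda>i. W i \<omega>) t0 x0 k))"
    by (simp add: o_def)
  then show ?eq ?int
    using integrable_entry[OF model] int
    by (auto intro: indep_var_lebesgue_integral indep_var_integrable)
qed

section \<open>Moments of the random state\<close>

context
  fixes M :: "'w measure" and W :: "nat \<Rightarrow> 'w \<Rightarrow> real^'m::finite^'m"
  assumes ind: "independent_model M W"
begin

lemma independent_random_model: "random_model M W"
  using ind by (simp add: independent_model_def)

interpretation prob_space M
  by (rule random_model_prob_space[OF independent_random_model])

lemma state_measurable [measurable]:
  "(\<lambda>\<omega>. dynamics (\<lambda>k. W k \<omega>) t0 x0 k) \<in> borel_measurable M"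
  by (rule borel_measurable_dynamics) (rule model_measurable[OF independent_random_model])

lemma state_abs_le:
  assumes "\<omega> \<in> space M"
  shows "\<bar>dynamics (\<lambda>k. W k \<omega>) t0 x0 k $ i\<bar> \<le> norm x0"
  by (rule dynamics_abs_le[where A = "\<lambda>k. W k \<omega>"])
    (simp_all add: model_stochastic[OF independent_random_model assms] component_le_norm_cart)

text \<open>The bound is uniform in \<open>k\<close>, so it also serves as the dominating constant
  in the limit of expectations.\<close>

lemma state_diff_abs_le:
  assumes "\<omega> \<in> space M"
  shows "\<bar>dynamics (\<lambda>k. W k \<omega>) t0 x0 k $ i - dynamics (\<lambda>k. W k \<omega>) t0 x0 k $ j\<bar> \<le> 2 * norm x0"
  using state_abs_le[OF assms, of t0 x0 k i] state_abs_le[OF assms, of t0 x0 k j] by linarith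

lemma integrable_state: "integrable M (\<lambda>\<omega>. dynamics (\<lambda>k. W k \<omega>) t0 x0 k $ i)"
  by (rule integrable_const_bound[of _ "norm x0"]) (auto simp: state_abs_le)

lemma integrable_state_diff_sq:
  "integrable M (\<lambda>\<omega>. (dynamics (\<lambda>k. W k \<omega>) t0 x0 k $ i - dynamics (\<lambda>k. W k \<omega>) t0 x0 k $ j)\<^sup>2)"
proof (rule integrable_const_bound[of _ "(2 * norm x0)\<^sup>2"])
  show "AE \<omega> in M. norm ((dynamics (\<lambda>k. W k \<omega>) t0 x0 k $ i - dynamics (\<lambda>k. W k \<omega>) t0 x0 k $ j)\<^sup>2)
      \<le> (2 * norm x0)\<^sup>2"
  proof (rule AE_I2)
    fix \<omega> assume "\<omega> \<in> space M"
    then have "\<bar>dynamics (\<lambda>k. W k \<omega>) t0 x0 k $ i - dynamics (\<lambda>k. W k \<omega>) t0 x0 k $ j\<bar>\<^sup>2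
      \<le> (2 * norm x0)\<^sup>2"
      by (intro power_mono state_diff_abs_le) auto
    then show "norm ((dynamics (\<lambda>k. W k \<omega>) t0 x0 k $ i - dynamics (\<lambda>k. W k \<omega>) t0 x0 k $ j)\<^sup>2)
      \<le> (2 * norm x0)\<^sup>2" by simp
  qed
qed simp

text \<open>Independence splits the expectation of each product \<open>W k\<close> times state, so
  the mean state obeys the recursion of the expected chain.\<close>

lemma expectation_state:
  "expectation (\<lambda>\<omega>. dynamics (\<lambda>k. W k \<omega>) t0 x0 k $ i) = dynamics (expected_model M W) t0 x0 k $ i"
proof (induction k arbitrary: i)
  case 0
  then show ?case by (simp add: prob_space)
next
  case (Suc k)
  show ?case
  proof (cases "t0 \<le> k")
    case True
    have "expectation (\<lambda>\<omega>. \<Sum>j\<in>UNIV. W k \<omega> $ i $ j * dynamics (\<lambda>k. W k \<omega>) t0 x0 k $ j) =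
      (\<Sum>j\<in>UNIV. expectation (\<lambda>\<omega>. W k \<omega> $ i $ j * dynamics (\<lambda>k. W k \<omega>) t0 x0 k $ j))"
      by (intro Bochner_Integration.integral_sum expectation_entry_times_state(2)[OF ind, where f = "\<lambda>x. x $ _"]
          integrable_state) measurable
    also have "\<dots> = (\<Sum>j\<in>UNIV. expected_model M W k $ i $ j * dynamics (expected_model M W) t0 x0 k $ j)"
      by (intro sum.cong refl, subst expectation_entry_times_state(1)[OF ind, where f = "\<lambda>x. x $ _"])
        (auto simp: integrable_state Suc expected_model_nth[OF independent_random_model])
    finally show ?thesis using True by (simp add: matrix_vector_mult_def)
  qed (simp add: prob_space)
qed

lemma ergodic_model_imp_expected:
  assumes "ergodic_model M W"
  shows "ergodic_chain (expected_model M W)"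
  unfolding ergodic_chain_def
proof (intro allI)
  fix t0 x0 i j
  have "(\<lambda>k. expectation (\<lambda>\<omega>. dynamics (\<lambda>k. W k \<omega>) t0 x0 k $ i - dynamics (\<lambda>k. W k \<omega>) t0 x0 k $ j))
    \<longlonglongrightarrow> expectation (\<lambda>\<omega>. 0)"
  proof (rule integral_dominated_convergence[where w = "\<lambda>_. 2 * norm x0"])
    show "AE \<omega> in M. (\<lambda>k. dynamics (\<lambda>k. W k \<omega>) t0 x0 k $ i - dynamics (\<lambda>k. W k \<omega>) t0 x0 k $ j) \<longlonglongrightarrow> 0"
      using assms unfolding ergodic_model_def by eventually_elim (simp add: ergodic_chain_def)
  qed (auto simp: state_diff_abs_le)
  then show "(\<lambda>k. dynamics (expected_model M W) t0 x0 k $ i - dynamics (expected_model M W) t0 x0 k $ j) \<longlonglongrightarrow> 0"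
    using integrable_state by (simp add: expectation_state)
qed

end

text \<open>Weak feedback bounds the expected entries by the second moments divided by
  \<open>\<gamma>\<close>, so each pair is dominated by the series in the class condition.\<close>

lemma class_M2_summable:
  fixes W :: "nat \<Rightarrow> 'w \<Rightarrow> real^'m::{finite,linorder}^'m::{finite,linorder}"
  assumes M2: "class_M2 M W" and wf: "weak_feedback M W"
  shows "summable (\<lambda>n. (\<integral>\<omega>. W (t0 + n) \<omega> $ i $ j \<partial>M) *
    (\<integral>\<omega>. (dynamics (\<lambda>k. W k \<omega>) t0 x0 (t0 + n) $ i - dynamics (\<lambda>k. W k \<omega>) t0 x0 (t0 + n) $ j)\<^sup>2 \<partial>M))"
proof -
  have ind: "independent_model M W" using M2 by (simp add: class_M2_def)
  note model = independent_random_model[OF ind]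
  define V where "V n i j = (\<integral>\<omega>. (dynamics (\<lambda>k. W k \<omega>) t0 x0 (t0 + n) $ i -
      dynamics (\<lambda>k. W k \<omega>) t0 x0 (t0 + n) $ j)\<^sup>2 \<partial>M)" for n i j
  define e where "e n i j = (\<integral>\<omega>. W (t0 + n) \<omega> $ i $ j \<partial>M)" for n i j
  define h where "h n i j = second_moment M W (t0 + n) $ i $ j" for n i j
  have V0: "0 \<le> V n i j" for n i j unfolding V_def by simp
  have Vsym: "V n i j = V n j i" for n i j unfolding V_def by (simp add: power2_commute)
  have e0: "0 \<le> e n i j" for n i j
    unfolding e_def by (rule integral_nonneg_AE) (auto simp: stochastic_entry[OF model_stochastic[OF model]])
  have h0: "0 \<le> h n i j" for n i j
    unfolding h_def second_moment_nth[OF model]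
    by (rule integral_nonneg_AE)
      (auto intro!: AE_I2 sum_nonneg simp: inner_vec_def column_def stochastic_entry[OF model_stochastic[OF model]])
  obtain \<gamma> where \<gamma>: "\<gamma> > 0" "\<And>n i j. i \<noteq> j \<Longrightarrow> \<gamma> * (e n i j + e n j i) \<le> h n i j"
    using wf unfolding weak_feedback_def e_def h_def second_moment_nth[OF model] by blast
  have sm: "summable (\<lambda>n. \<Sum>(i, j)\<in>{(i, j). i < j}. h n i j * V n i j)"
    using M2 unfolding class_M2_def h_def V_def by blast
  have lt: "summable (\<lambda>n. (e n i j + e n j i) * V n i j)" if "i < j" for i j
  proof (rule summable_comparison_test'[where N = 0])
    show "summable (\<lambda>n. (1 / \<gamma>) * (\<Sum>(i, j)\<in>{(i, j). i < j}. h n i j * V n i j))"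
      by (rule summable_mult[OF sm])
    fix n
    have "\<gamma> * (e n i j + e n j i) * V n i j \<le> h n i j * V n i j"
      using \<gamma>(2)[of i j n] that V0 by (intro mult_right_mono) auto
    also have "\<dots> \<le> (\<Sum>(i, j)\<in>{(i, j). i < j}. h n i j * V n i j)"
      using member_le_sum[of "(i, j)" "{(i, j). i < j}" "\<lambda>(i, j). h n i j * V n i j"] that h0 V0
      by auto
    finally show "norm ((e n i j + e n j i) * V n i j) \<le>
        (1 / \<gamma>) * (\<Sum>(i, j)\<in>{(i, j). i < j}. h n i j * V n i j)"
      using \<gamma>(1) e0 V0 by (simp add: field_simps)
  qed
  \<comment> \<open>The class condition covers \<open>i < j\<close> only. The summand is symmetric
    in \<open>i\<close> and \<open>j\<close>, and on the diagonal \<open>V\<close> vanishes.\<close>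
  have sum2: "summable (\<lambda>n. (e n i j + e n j i) * V n i j)"
  proof (cases i j rule: linorder_cases)
    case greater
    then show ?thesis using lt[of j i] by (simp add: Vsym[of _ i j] add.commute)
  qed (use lt in \<open>auto simp: V_def\<close>)
  have "summable (\<lambda>n. e n i j * V n i j)"
    by (rule summable_comparison_test'[OF sum2, where N = 0])
      (use e0 V0 in \<open>auto simp: abs_mult intro!: mult_right_mono\<close>)
  then show ?thesis unfolding e_def V_def .
qed

text \<open>By independence of \<open>W(k)\<close> and \<open>x(k)\<close> the summable products of expectations are expectations
  of products, so almost every realization satisfies the hypotheses of the deterministic criterion.\<close>

lemma infinite_flow_imp_ergodic_model:
  fixes W :: "nat \<Rightarrow> 'w \<Rightarrow> real^'m::{finite,linorder}^'m::{finite,linorder}"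
  assumes M2: "class_M2 M W" and wf: "weak_feedback M W" and flow: "infinite_flow_model M W"
  shows "ergodic_model M W"
proof -
  have ind: "independent_model M W" using M2 by (simp add: class_M2_def)
  note model = independent_random_model[OF ind]
  interpret prob_space M by (rule random_model_prob_space[OF model])
  define x where "x \<omega> t0 l n = dynamics (\<lambda>k. W k \<omega>) t0 (axis l 1) (t0 + n)" for \<omega> t0 l n
  have "AE \<omega> in M. summable (\<lambda>n. W (t0 + n) \<omega> $ i $ j * (x \<omega> t0 l n $ i - x \<omega> t0 l n $ j)\<^sup>2)"
    for t0 l i j
  proof (rule AE_summable)
    have f: "(\<lambda>v::real^'m::{finite,linorder}. (v $ i - v $ j)\<^sup>2) \<in> borel_measurable borel" by measurable
    note prod = expectation_entry_times_state[OF ind f integrable_state_diff_sq[OF ind]]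
    show "integrable M (\<lambda>\<omega>. W (t0 + n) \<omega> $ i $ j * (x \<omega> t0 l n $ i - x \<omega> t0 l n $ j)\<^sup>2)" for n
      unfolding x_def by (rule prod)
    show "summable (\<lambda>n. expectation (\<lambda>\<omega>. W (t0 + n) \<omega> $ i $ j * (x \<omega> t0 l n $ i - x \<omega> t0 l n $ j)\<^sup>2))"
      unfolding x_def prod by (rule class_M2_summable[OF M2 wf])
  qed (simp add: stochastic_entry[OF model_stochastic[OF model]])
  \<comment> \<open>With basis vectors as initial states there are only countably many choices of
    \<open>t0\<close>, \<open>l\<close>, \<open>i\<close>, \<open>j\<close>, so one null set serves
    all.\<close>
  then have "AE \<omega> in M. \<forall>t0 l i j.
      summable (\<lambda>n. W (t0 + n) \<omega> $ i $ j * (x \<omega> t0 l n $ i - x \<omega> t0 l n $ j)\<^sup>2)"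
    by (simp add: AE_all_countable)
  then show ?thesis
    using flow[unfolded infinite_flow_model_def] AE_space unfolding ergodic_model_def
  proof eventually_elim
    case (elim \<omega>)
    have A: "stochastic (W k \<omega>)" for k using model_stochastic[OF model] elim by simp
    show ?case
    proof (rule ergodic_chain_axisI)
      fix t0 l i j
      have x01: "0 \<le> x \<omega> t0 l n $ i" "x \<omega> t0 l n $ i \<le> 1" for n i
        unfolding x_def by (rule dynamics_unit_interval[OF A]; simp add: axis_def)+
      have nsm: "\<not> summable (\<lambda>k. flow (W (t0 + k) \<omega>) S)" if "S \<noteq> {}" "S \<noteq> UNIV" for S
        using elim(2) that unfolding infinite_flow_chain_iff[of "\<lambda>k. W k \<omega>", OF A]
        by (subst add.commute) (simp add: summable_iff_shift[of "\<lambda>k. flow (W k \<omega>) S"])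
      have "(\<lambda>n. x \<omega> t0 l n $ i - x \<omega> t0 l n $ j) \<longlonglongrightarrow> 0"
      proof (rule trajectory_consensus[where A = "\<lambda>n. W (t0 + n) \<omega>"], goal_cases)
        case (2 n)
        show "x \<omega> t0 l (Suc n) = W (t0 + n) \<omega> *v x \<omega> t0 l n"
          unfolding x_def by (rule dynamics_shift_Suc)
      qed (use elim(1) in \<open>simp_all add: A x01 nsm\<close>)
      then show "(\<lambda>k. dynamics (\<lambda>k. W k \<omega>) t0 (axis l 1) k $ i - dynamics (\<lambda>k. W k \<omega>) t0 (axis l 1) k $ j)
          \<longlonglongrightarrow> 0"
        by - (rule LIMSEQ_offset[where k = t0], simp add: x_def add.commute)
    qed
  qed
qed

theorem theorem4:
  fixes M :: "'w measure"
    and W :: "nat \<Rightarrow> 'w \<Rightarrow> real^'m::{finite,linorder}^'m::{finite,linorder}"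
  assumes "class_M2 M W" and "weak_feedback M W"
  shows "(ergodic_model M W \<longleftrightarrow> infinite_flow_model M W) \<and>
         (infinite_flow_model M W \<longleftrightarrow> infinite_flow_chain (expected_model M W)) \<and>
         (infinite_flow_chain (expected_model M W) \<longleftrightarrow> ergodic_chain (expected_model M W))"
proof -
  have ind: "independent_model M W" using assms(1) by (simp add: class_M2_def)
  note model = independent_random_model[OF ind]
  \<comment> \<open>The implications, in order: (a) to (b), (b) to (c), (c) to (b), (a) to (d), (b)
    to (a), (d) to (c).\<close>
  show ?thesis
    using ergodic_model_imp_infinite_flow[OF model] infinite_flow_model_imp_expected[OF model]
      expected_imp_infinite_flow_model[OF ind] ergodic_model_imp_expected[OF ind]
      infinite_flow_imp_ergodic_model[OF assms]
      ergodic_imp_infinite_flow[of "expected_model M W", OF stochastic_expected_model[OF model]]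
    by blast
qed

end
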